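(* Let $b\ge2$ be an integer, let $\mathbf{a},\mathbf{b}$ be distinct integers in $\{0,1,\dots,b-1\}$, and let $\theta\in(0,1)$ be irrational. Let $\xi_0=\sum_{n\ge1}c_nb^{-n}$, where $c_1c_2\cdots$ is the characteristic Sturmian word of slope $\theta$ over $\{\mathbf{a},\mathbf{b}\}$, and let $\xi_1=\xi_{\mathbf{x}}=\sum_{n\ge1}x_nb^{-n}$, where $\mathbf{x}=x_1x_2\cdots$ is a Sturmian word (lower or upper) over $\{\mathbf{a},\mathbf{b}\}$ of slope $\theta$. Then $1,\xi_0,\xi_1$ are linearly independent over $\mathbb{Q}$ if and only if there is no integer $j$ such that the intercept of $\mathbf{x}$ is congruent to $j\theta$ modulo one.
   Context: For real $\theta,\rho$ with $0\le\theta,\rho<1$ and $\theta$ irrational, put for $n\ge0$: $s_n=\lfloor (n+1)\theta+\rho\rfloor-\lfloor n\theta+\rho\rfloor$ and $s'_n=\lceil (n+1)\theta+\rho\rceil-\lceil n\theta+\rho\rceil$. The words $s_0s_1\cdots$ and $s'_0s'_1\cdots$ over $\{0,1\}$ are the lower and upper Sturmian words of slope $\theta$ and intercept $\rho$. For $\rho=0$ they differ only in the first letter, so there is an infinite word $\mathbf{c}_\theta$ (the characteristic Sturmian word of slope $\theta$) with $s_0s_1\cdots=0\mathbf{c}_\theta$, $s'_0s'_1\cdots=1\mathbf{c}_\theta$. Sturmian words over $\{\mathbf{a},\mathbf{b}\}$ are obtained by replacing $0$ by $\mathbf{a}$ and $1$ by $\mathbf{b}$. *)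

theory Defs
  imports "HOL-Analysis.Analysis" "HOL-Library.Real_Mod"
begin

text \<open>Infinite words are functions on \<open>nat\<close>; the letter in position \<open>0\<close> is the first one.\<close>

definition lower_sturmian :: "real \<Rightarrow> real \<Rightarrow> nat \<Rightarrow> int" where
  "lower_sturmian \<theta> \<rho> n =
     \<lfloor>real (n + 1) * \<theta> + \<rho>\<rfloor> - \<lfloor>real n * \<theta> + \<rho>\<rfloor>"

definition upper_sturmian :: "real \<Rightarrow> real \<Rightarrow> nat \<Rightarrow> int" where
  "upper_sturmian \<theta> \<rho> n =
     \<lceil>real (n + 1) * \<theta> + \<rho>\<rceil> - \<lceil>real n * \<theta> + \<rho>\<rceil>"

text \<open>The characteristic word is the common tail of the lower and the upper word of
  intercept \<open>0\<close>, see \<open>lower_sturmian_zero\<close> and \<open>upper_sturmian_zero\<close>.\<close>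

definition char_sturmian :: "real \<Rightarrow> nat \<Rightarrow> int" where
  "char_sturmian \<theta> n = lower_sturmian \<theta> 0 (Suc n)"

definition recode :: "'a \<Rightarrow> 'a \<Rightarrow> (nat \<Rightarrow> int) \<Rightarrow> nat \<Rightarrow> 'a" where
  "recode u v s n = (if s n = 0 then u else v)"

definition is_sturmian :: "'a \<Rightarrow> 'a \<Rightarrow> real \<Rightarrow> real \<Rightarrow> (nat \<Rightarrow> 'a) \<Rightarrow> bool" where
  "is_sturmian u v \<theta> \<rho> x \<longleftrightarrow>
     x = recode u v (lower_sturmian \<theta> \<rho>) \<or> x = recode u v (upper_sturmian \<theta> \<rho>)"

definition base_value :: "int \<Rightarrow> (nat \<Rightarrow> int) \<Rightarrow> real" where
  "base_value b x = (\<Sum>n. of_int (x n) / of_int b ^ Suc n)"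

text \<open>Independence of a family, not of a set: a list with a repeated entry is dependent.\<close>

definition rat_lin_indep :: "real list \<Rightarrow> bool" where
  "rat_lin_indep xs \<longleftrightarrow>
     (\<forall>q :: nat \<Rightarrow> rat. (\<Sum>i<length xs. of_rat (q i) * xs ! i) = 0 \<longrightarrow>
        (\<forall>i<length xs. q i = 0))"

lemma floor_unit_range:
  fixes \<theta> y :: real
  assumes "0 < \<theta>" "\<theta> < 1"
  shows "\<lfloor>y + \<theta>\<rfloor> - \<lfloor>y\<rfloor> \<in> {0, 1}" "\<lceil>y + \<theta>\<rceil> - \<lceil>y\<rceil> \<in> {0, 1}"
  using assms by (simp, linarith)+

lemma lower_sturmian_range:
  assumes "0 < \<theta>" "\<theta> < 1"
  shows "lower_sturmian \<theta> \<rho> n \<in> {0, 1}"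
  using floor_unit_range(1)[OF assms, of "real n * \<theta> + \<rho>"]
  by (simp add: lower_sturmian_def algebra_simps)

lemma upper_sturmian_range:
  assumes "0 < \<theta>" "\<theta> < 1"
  shows "upper_sturmian \<theta> \<rho> n \<in> {0, 1}"
  using floor_unit_range(2)[OF assms, of "real n * \<theta> + \<rho>"]
  by (simp add: upper_sturmian_def algebra_simps)

lemma lower_sturmian_zero:
  assumes "0 < \<theta>" "\<theta> < 1"
  shows "lower_sturmian \<theta> 0 = case_nat 0 (char_sturmian \<theta>)"
proof
  fix n
  show "lower_sturmian \<theta> 0 n = case_nat 0 (char_sturmian \<theta>) n"
  proof (cases n)
    case 0
    have "\<lfloor>\<theta>\<rfloor> = 0" using assms by linarith
    with 0 show ?thesis by (simp add: lower_sturmian_def)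
  qed (simp add: char_sturmian_def)
qed

lemma upper_sturmian_zero:
  assumes "0 < \<theta>" "\<theta> < 1" "\<theta> \<notin> \<rat>"
  shows "upper_sturmian \<theta> 0 = case_nat 1 (char_sturmian \<theta>)"
proof
  fix n
  have ceil: "\<lceil>real (Suc k) * \<theta>\<rceil> = \<lfloor>real (Suc k) * \<theta>\<rfloor> + 1" for k
  proof -
    have "real (Suc k) * \<theta> \<notin> \<int>"
    proof
      assume "real (Suc k) * \<theta> \<in> \<int>"
      then have "real (Suc k) * \<theta> / real (Suc k) \<in> \<rat>"
        using Ints_subset_Rats by (intro Rats_divide) auto
      with assms(3) show False by simp
    qed
    then show ?thesis by (simp add: ceiling_altdef Ints_def) (metis rangeI)
  qed
  show "upper_sturmian \<theta> 0 n = case_nat 1 (char_sturmian \<theta>) n"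
  proof (cases n)
    case 0
    have "\<lceil>\<theta>\<rceil> = 1" using assms by linarith
    with 0 show ?thesis by (simp add: upper_sturmian_def)
  next
    case (Suc m)
    then show ?thesis
      using ceil[of m] ceil[of "Suc m"]
      by (simp add: upper_sturmian_def char_sturmian_def lower_sturmian_def add.commute)
  qed
qed

end

theory Submission
  imports Defs
begin

text \<open>
  If \<open>\<rho> = j\<theta> + i\<close>, the two words have a common tail and \<open>\<xi>\<^sub>1\<close> is an affine image of \<open>\<xi>\<^sub>0\<close> with
  rational coefficients.

  For the converse write \<open>T y\<close> for the value of the lower word of intercept \<open>y\<close>. A rational
  relation, with denominators cleared, says that \<open>H y = B T (y + \<theta>) + C T (y + \<rho>)\<close> is an integer
  at \<open>y = 0\<close>; dropping leading digits shows that it is an integer at every \<open>y = n\<theta>\<close>. The points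
  \<open>n\<theta>\<close> are dense modulo one, hence the one-sided limits of \<open>H\<close> are integers everywhere, and so are
  its jumps. But \<open>T\<close> jumps by \<open>(b - 1) / b ^ (m + 1)\<close> at \<open>-m\<theta>\<close> for \<open>m \<ge> 1\<close> and is continuous off
  \<open>\<int>\<theta> + \<int>\<close>. If \<open>\<rho> \<notin> \<int>\<theta> + \<int>\<close>, the jumps of the two summands of \<open>H\<close> do not interfere, and they
  are too small to be integers for large \<open>m\<close> unless \<open>B = C = 0\<close>.
\<close>

section \<open>Values of bounded integer words in base \<open>b\<close>\<close>

lemma summable_base_value:
  fixes b :: int and w :: "nat \<Rightarrow> int"
  assumes "b \<ge> 2" and "\<And>n. \<bar>w n\<bar> \<le> M"
  shows "summable (\<lambda>n. real_of_int (w n) / of_int b ^ Suc n)"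
proof (rule summable_comparison_test')
  show "summable (\<lambda>n. real_of_int M * (1 / of_int b) ^ Suc n)"
    using assms(1) by (intro summable_mult) (simp add: summable_Suc_iff summable_geometric)
  show "norm (real_of_int (w n) / of_int b ^ Suc n) \<le> real_of_int M * (1 / of_int b) ^ Suc n" for n
  proof -
    have "\<bar>real_of_int (w n)\<bar> \<le> real_of_int M"
      using assms(2)[of n] by linarith
    then show ?thesis
      using assms(1) by (simp add: abs_mult power_one_over field_simps)
  qed
qed

text \<open>The majorant \<open>M / b ^ Suc n\<close> does not depend on \<open>t\<close>, so the
  Weierstrass test allows the limit to be taken digit by digit. Digits are integers, which is why
  their convergence is phrased as eventual equality.\<close>

lemma base_value_tendsto:
  fixes b :: int and w :: "'a \<Rightarrow> nat \<Rightarrow> int"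
  assumes "b \<ge> 2" and "\<And>t n. \<bar>w t n\<bar> \<le> M" and "\<And>n. \<bar>l n\<bar> \<le> M"
    and "\<And>n. eventually (\<lambda>t. w t n = l n) F"
  shows "((\<lambda>t. base_value b (w t)) \<longlongrightarrow> base_value b l) F"
  unfolding base_value_def
proof (rule swap_uniform_limit'[where S = UNIV and F = sequentially])
  show "(\<lambda>N. \<Sum>n<N. real_of_int (l n) / of_int b ^ Suc n)
          \<longlonglongrightarrow> (\<Sum>n. real_of_int (l n) / of_int b ^ Suc n)"
    using assms by (intro summable_LIMSEQ summable_base_value)
  show "\<forall>\<^sub>F N in sequentially. ((\<lambda>t. \<Sum>n<N. real_of_int (w t n) / of_int b ^ Suc n)
          \<longlongrightarrow> (\<Sum>n<N. real_of_int (l n) / of_int b ^ Suc n)) F"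
  proof (intro always_eventually allI tendsto_sum)
    fix n
    show "((\<lambda>t. real_of_int (w t n) / of_int b ^ Suc n) \<longlongrightarrow> real_of_int (l n) / of_int b ^ Suc n) F"
      by (rule tendsto_eventually, rule eventually_mono[OF assms(4)[of n]]) simp
  qed
  show "uniform_limit UNIV (\<lambda>N t. \<Sum>n<N. real_of_int (w t n) / of_int b ^ Suc n)
          (\<lambda>t. \<Sum>n. real_of_int (w t n) / of_int b ^ Suc n) sequentially"
  proof (rule Weierstrass_m_test)
    show "summable (\<lambda>n. real_of_int M / of_int b ^ Suc n)"
      using assms(1) by (rule summable_base_value[where M = "\<bar>M\<bar>"]) simp
    show "norm (real_of_int (w t n) / of_int b ^ Suc n) \<le> real_of_int M / of_int b ^ Suc n" for t n
    proof -
      have "\<bar>real_of_int (w t n)\<bar> \<le> real_of_int M"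
        using assms(2)[of t n] by linarith
      then show ?thesis
        using assms(1) by (simp add: abs_mult divide_right_mono)
    qed
  qed
qed auto

text \<open>Multiplying by \<open>b ^ N\<close> moves the first \<open>N\<close> digits in front of
  the radix point, where they form the integer \<open>k\<close>.\<close>

lemma base_value_shift:
  fixes b :: int and w :: "nat \<Rightarrow> int"
  assumes "b \<ge> 2" and "\<And>n. \<bar>w n\<bar> \<le> M"
  shows "\<exists>k::int. base_value b (\<lambda>n. w (n + N)) = of_int b ^ N * base_value b w - of_int k"
proof (induction N)
  case 0
  show ?case by (intro exI[of _ 0]) simp
next
  case (Suc N)
  define w' where "w' n = w (n + N)" for n
  have b: "real_of_int b \<noteq> 0" using assms(1) by simp
  have "base_value b w' = (\<Sum>n. real_of_int (w' (Suc n)) / of_int b ^ Suc (Suc n)) + w' 0 / of_int b"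
    unfolding base_value_def
    using suminf_split_head[OF summable_base_value[of b w' M]] assms by (simp add: w'_def)
  also have "(\<Sum>n. real_of_int (w' (Suc n)) / of_int b ^ Suc (Suc n))
               = base_value b (\<lambda>n. w' (Suc n)) / of_int b"
    unfolding base_value_def
    using suminf_divide[OF summable_base_value[of b "\<lambda>n. w' (Suc n)" M], of "of_int b"] assms
    by (simp add: w'_def mult.commute)
  finally have "base_value b (\<lambda>n. w' (Suc n)) = of_int b * base_value b w' - w' 0"
    using b by (simp add: field_simps)
  moreover obtain k where "base_value b w' = of_int b ^ N * base_value b w - of_int k"
    using Suc.IH unfolding w'_def by blast
  \<comment> \<open>Horner step: the digits dropped so far make up \<open>k\<close>, and
    \<open>w' 0\<close> is the next one.\<close>
  ultimately show ?case
    by (intro exI[of _ "b * k + w' 0"]) (simp add: w'_def algebra_simps)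
qed

text \<open>Each letter is \<open>u + (v - u) * s n\<close>, and the constant word \<open>u\<close>
  has the value \<open>u / (b - 1)\<close> by the geometric series.\<close>

lemma base_value_recode:
  assumes "b \<ge> 2" and "\<And>n. s n \<in> {0, 1}"
  shows "base_value b (recode u v s) = of_int u / of_int (b - 1) + of_int (v - u) * base_value b s"
proof -
  have s: "\<bar>s n\<bar> \<le> 1" for n using assms(2)[of n] by auto
  have g: "(\<lambda>n. real_of_int u / of_int b ^ Suc n) sums (of_int u / of_int (b - 1))"
  proof -
    have "(\<lambda>n. (real_of_int u / of_int b) * (1 / of_int b) ^ n)
             sums ((real_of_int u / of_int b) * (1 / (1 - 1 / of_int b)))"
      using assms(1) by (intro sums_mult geometric_sums) simp
    then show ?thesis
      using assms(1) by (simp add: power_one_over field_simps)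
  qed
  have "(\<lambda>n. real_of_int (v - u) * (real_of_int (s n) / of_int b ^ Suc n))
          sums (of_int (v - u) * base_value b s)"
    unfolding base_value_def
    by (intro sums_mult summable_sums summable_base_value[OF assms(1) s])
  from sums_add[OF g this]
  have "(\<lambda>n. real_of_int u / of_int b ^ Suc n + real_of_int (v - u) * (real_of_int (s n) / of_int b ^ Suc n))
     sums (of_int u / of_int (b - 1) + of_int (v - u) * base_value b s)" .
  moreover have "real_of_int u / of_int b ^ Suc n + real_of_int (v - u) * (real_of_int (s n) / of_int b ^ Suc n)
      = real_of_int (recode u v s n) / of_int b ^ Suc n" for n
    using assms(2)[of n] by (auto simp: recode_def diff_divide_distrib)
  ultimately show ?thesis
    unfolding base_value_def by (simp only: sums_iff)
qed

section \<open>One-sided limits and jumps in the intercept\<close>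

lemma abs_lower_sturmian_le: "0 < \<theta> \<Longrightarrow> \<theta> < 1 \<Longrightarrow> \<bar>lower_sturmian \<theta> y n\<bar> \<le> 1"
  using lower_sturmian_range[of \<theta> y n] by auto

lemma abs_upper_sturmian_le: "0 < \<theta> \<Longrightarrow> \<theta> < 1 \<Longrightarrow> \<bar>upper_sturmian \<theta> y n\<bar> \<le> 1"
  using upper_sturmian_range[of \<theta> y n] by auto

lemma eventually_floor_at_right:
  fixes a z :: real
  shows "eventually (\<lambda>y. \<lfloor>a + y\<rfloor> = \<lfloor>a + z\<rfloor>) (at_right z)"
  unfolding eventually_at_right_field
  by (rule exI[of _ "of_int \<lfloor>a + z\<rfloor> + 1 - a"]) (safe, linarith+)

text \<open>Between the last integer strictly below \<open>a + z\<close> and \<open>a + z\<close>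
  itself the floor is constant; that integer is the ceiling minus 1 whether or not
  \<open>a + z\<close> is an integer.\<close>

lemma eventually_floor_at_left:
  fixes a z :: real
  shows "eventually (\<lambda>y. \<lfloor>a + y\<rfloor> = \<lceil>a + z\<rceil> - 1) (at_left z)"
  unfolding eventually_at_left_field
  by (rule exI[of _ "of_int \<lceil>a + z\<rceil> - 1 - a"]) (safe, linarith+)

lemma base_value_lower_sturmian_at_right:
  assumes "b \<ge> 2" "0 < \<theta>" "\<theta> < 1"
  shows "((\<lambda>y. base_value b (lower_sturmian \<theta> y)) \<longlongrightarrow> base_value b (lower_sturmian \<theta> z)) (at_right z)"
proof (rule base_value_tendsto[OF assms(1), where M = 1])
  fix n
  show "\<forall>\<^sub>F y in at_right z. lower_sturmian \<theta> y n = lower_sturmian \<theta> z n"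
    using eventually_floor_at_right[of "real (n + 1) * \<theta>" z] eventually_floor_at_right[of "real n * \<theta>" z]
    by eventually_elim (simp add: lower_sturmian_def)
qed (use assms abs_lower_sturmian_le in auto)

text \<open>To the left of \<open>z\<close> the floors settle at the ceilings minus 1; the 1 cancels
  between consecutive terms, and the differences of ceilings form the upper word.\<close>

lemma base_value_lower_sturmian_at_left:
  assumes "b \<ge> 2" "0 < \<theta>" "\<theta> < 1"
  shows "((\<lambda>y. base_value b (lower_sturmian \<theta> y)) \<longlongrightarrow> base_value b (upper_sturmian \<theta> z)) (at_left z)"
proof (rule base_value_tendsto[OF assms(1), where M = 1])
  fix n
  show "\<forall>\<^sub>F y in at_left z. lower_sturmian \<theta> y n = upper_sturmian \<theta> z n"
    using eventually_floor_at_left[of "real (n + 1) * \<theta>" z] eventually_floor_at_left[of "real n * \<theta>" z]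
    by eventually_elim (simp add: lower_sturmian_def upper_sturmian_def)
qed (use assms abs_lower_sturmian_le abs_upper_sturmian_le in auto)

lemma lower_eq_upper_sturmian:
  assumes "\<And>n::nat. real n * \<theta> + y \<notin> \<int>"
  shows "lower_sturmian \<theta> y = upper_sturmian \<theta> y"
proof
  fix n
  have "\<lceil>real k * \<theta> + y\<rceil> = \<lfloor>real k * \<theta> + y\<rfloor> + 1" for k
    using assms[of k] by (auto simp: ceiling_altdef) (metis Ints_of_int)
  from this[of n] this[of "n + 1"] show "lower_sturmian \<theta> y n = upper_sturmian \<theta> y n"
    by (simp add: lower_sturmian_def upper_sturmian_def)
qed

lemma irrational_mult_int_eq_int:
  fixes \<theta> :: real
  assumes "\<theta> \<notin> \<rat>" and "of_int k * \<theta> \<in> \<int>"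
  shows "k = 0"
proof (rule ccontr)
  assume "k \<noteq> 0"
  then have "\<theta> = (of_int k * \<theta>) / of_int k" by simp
  also have "\<dots> \<in> \<rat>" using assms(2) Ints_subset_Rats by (intro Rats_divide) auto
  finally show False using assms(1) by simp
qed

text \<open>Ceiling and floor of \<open>real n * \<theta> + z\<close> differ by 1 except at
  \<open>n = Suc m\<close>, where the argument is 0. So the words differ by 1 in position
  \<open>m\<close>, by -1 in position \<open>Suc m\<close> and nowhere else, which is worth
  \<open>1 / b ^ (m + 1) - 1 / b ^ (m + 2)\<close>. With \<open>m\<close> instead of
  \<open>Suc m\<close> the first of these positions could be missing.\<close>

lemma base_value_sturmian_jump:
  fixes m :: nat
  assumes "b \<ge> 2" "0 < \<theta>" "\<theta> < 1" "\<theta> \<notin> \<rat>"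
  defines "z \<equiv> - real (Suc m) * \<theta>"
  shows "base_value b (lower_sturmian \<theta> z) - base_value b (upper_sturmian \<theta> z)
           = of_int (b - 1) / of_int b ^ (m + 2)"
proof -
  have ceil: "\<lceil>real n * \<theta> + z\<rceil> - \<lfloor>real n * \<theta> + z\<rfloor> = (if n = Suc m then 0 else 1)" for n
  proof (cases "n = Suc m")
    case True
    then have "real n * \<theta> + z = 0" by (simp add: z_def algebra_simps)
    then show ?thesis using True by simp
  next
    case False
    have "real n * \<theta> + z = of_int (int n - int (Suc m)) * \<theta>"
      by (simp add: z_def algebra_simps)
    then have "real n * \<theta> + z \<notin> \<int>"
      using irrational_mult_int_eq_int[OF assms(4), of "int n - int (Suc m)"] False by auto
    then show ?thesis using False by (auto simp: ceiling_altdef) (metis Ints_of_int)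
  qed
  have diff: "lower_sturmian \<theta> z n - upper_sturmian \<theta> z n
      = (if n = m then 1 else if n = Suc m then -1 else 0)" for n
    using ceil[of n] ceil[of "n + 1"] unfolding lower_sturmian_def upper_sturmian_def
    by (auto split: if_splits)
  have "base_value b (lower_sturmian \<theta> z) - base_value b (upper_sturmian \<theta> z)
      = (\<Sum>n. real_of_int (lower_sturmian \<theta> z n - upper_sturmian \<theta> z n) / of_int b ^ Suc n)"
    unfolding base_value_def
    by (subst suminf_diff[OF summable_base_value[of b _ 1] summable_base_value[of b _ 1]])
       (use assms abs_lower_sturmian_le abs_upper_sturmian_le in \<open>auto simp: diff_divide_distrib\<close>)
  also have "\<dots> = (\<Sum>n\<in>{m, Suc m}. real_of_int (lower_sturmian \<theta> z n - upper_sturmian \<theta> z n) / of_int b ^ Suc n)"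
    by (rule suminf_finite) (auto simp: diff simp del: of_int_diff)
  also have "\<dots> = of_int (b - 1) / of_int b ^ (m + 2)"
    using assms(1) by (simp add: diff field_simps del: of_int_diff)
  finally show ?thesis .
qed

section \<open>Density of the orbit of \<theta> modulo one\<close>

lemma irrational_orbit_dense:
  fixes \<theta> c d :: real
  assumes "\<theta> \<notin> \<rat>" and "c < d"
  shows "\<exists>(n::nat) (p::int). c < real n * \<theta> + of_int p \<and> real n * \<theta> + of_int p < d"
proof -
  \<comment> \<open>The midpoint of the interval is approximated within half its length. The
    multiplier \<open>k\<close> comes out positive, so the forward orbit is enough.\<close>
  have "(d - c) / 2 > 0" using assms(2) by simp
  then obtain h k where "k > 0" "\<bar>of_int k * \<theta> - of_int h - (c + d) / 2\<bar> < (d - c) / 2"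
    using sequence_of_fractional_parts_is_dense[OF assms(1)] by blast
  then show ?thesis
    by (intro exI[of _ "nat k"] exI[of _ "-h"]) (auto simp: abs_less_iff field_simps)
qed

text \<open>The integers are closed: a limit outside them would keep \<open>f\<close> off the
  integers on a whole interval to the right of \<open>z\<close>, but such an interval contains an
  orbit point.\<close>

lemma lim_right_Ints:
  fixes f :: "real \<Rightarrow> real"
  assumes "\<theta> \<notin> \<rat>" and "\<And>(n::nat) (p::int). f (real n * \<theta> + of_int p) \<in> \<int>"
    and "(f \<longlongrightarrow> l) (at_right z)"
  shows "l \<in> \<int>"
proof (rule ccontr)
  assume "l \<notin> \<int>"
  then have "\<forall>\<^sub>F y in at_right z. f y \<in> - \<int>"
    using assms(3) by (intro topological_tendstoD) (auto simp: closed_Ints open_Compl)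
  then obtain d where "z < d" "\<And>y. z < y \<Longrightarrow> y < d \<Longrightarrow> f y \<notin> \<int>"
    unfolding eventually_at_right_field by auto
  with irrational_orbit_dense[OF assms(1) \<open>z < d\<close>] assms(2) show False by blast
qed

lemma lim_left_Ints:
  fixes f :: "real \<Rightarrow> real"
  assumes "\<theta> \<notin> \<rat>" and "\<And>(n::nat) (p::int). f (real n * \<theta> + of_int p) \<in> \<int>"
    and "(f \<longlongrightarrow> l) (at_left z)"
  shows "l \<in> \<int>"
proof (rule ccontr)
  assume "l \<notin> \<int>"
  then have "\<forall>\<^sub>F y in at_left z. f y \<in> - \<int>"
    using assms(3) by (intro topological_tendstoD) (auto simp: closed_Ints open_Compl)
  then obtain c where "c < z" "\<And>y. c < y \<Longrightarrow> y < z \<Longrightarrow> f y \<notin> \<int>"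
    unfolding eventually_at_left_field by auto
  with irrational_orbit_dense[OF assms(1) \<open>c < z\<close>] assms(2) show False by blast
qed

section \<open>Integer relations between two lower words\<close>

lemma lower_sturmian_add_int: "lower_sturmian \<theta> (y + of_int p) = lower_sturmian \<theta> y"
  by (rule ext) (simp add: lower_sturmian_def add.assoc[symmetric])

lemma lower_sturmian_shift: "lower_sturmian \<theta> (real N * \<theta> + y) = (\<lambda>n. lower_sturmian \<theta> y (n + N))"
  by (rule ext) (simp add: lower_sturmian_def algebra_simps)

text \<open>By \<open>nc\<close> the jumps of the \<alpha> term are met by no jump of the \<beta>
  term, so they are integers, yet they tend to 0. Both intercepts are arbitrary, so that exchanging
  the two terms also removes \<open>C\<close>.\<close>

lemma int_relation_coeff_zero:
  fixes \<theta> \<alpha> \<beta> :: real and b B C :: int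
  assumes b: "b \<ge> 2" and \<theta>: "0 < \<theta>" "\<theta> < 1" "\<theta> \<notin> \<rat>"
    and nc: "\<And>j i :: int. \<beta> - \<alpha> \<noteq> of_int j * \<theta> + of_int i"
    and rel: "of_int B * base_value b (lower_sturmian \<theta> \<alpha>)
              + of_int C * base_value b (lower_sturmian \<theta> \<beta>) \<in> \<int>"
  shows "B = 0"
proof -
  define T where "T y = base_value b (lower_sturmian \<theta> y)" for y
  define U where "U y = base_value b (upper_sturmian \<theta> y)" for y
  define H where "H y = of_int B * T (y + \<alpha>) + of_int C * T (y + \<beta>)" for y
  have shift: "\<exists>k::int. T (real n * \<theta> + of_int p + y) = of_int b ^ n * T y - of_int k"
    for n :: nat and p :: int and y
  proof -
    have "T (real n * \<theta> + of_int p + y) = base_value b (\<lambda>i. lower_sturmian \<theta> y (i + n))"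
      using lower_sturmian_add_int[of \<theta> "real n * \<theta> + y" p]
      by (simp add: T_def lower_sturmian_shift[symmetric] add_ac)
    then show ?thesis
      using base_value_shift[of b "lower_sturmian \<theta> y" 1 n, OF b abs_lower_sturmian_le[OF \<theta>(1,2)]] by (simp add: T_def)
  qed
  have orbit: "H (real n * \<theta> + of_int p) \<in> \<int>" for n :: nat and p :: int
  proof -
    obtain k where k: "T (real n * \<theta> + of_int p + \<alpha>) = of_int b ^ n * T \<alpha> - of_int k"
      using shift by blast
    obtain l where l: "T (real n * \<theta> + of_int p + \<beta>) = of_int b ^ n * T \<beta> - of_int l"
      using shift by blast
    have "H (real n * \<theta> + of_int p)
        = of_int (b ^ n) * (of_int B * T \<alpha> + of_int C * T \<beta>) - of_int (B * k + C * l)"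
      unfolding H_def k l by (simp add: algebra_simps)
    also have "\<dots> \<in> \<int>"
      using rel unfolding T_def by (intro Ints_diff Ints_mult Ints_of_int)
    finally show ?thesis .
  qed
  have jump: "of_int B * (of_int (b - 1) / of_int b ^ (m + 2)) \<in> (\<int> :: real set)" for m
  proof -
    \<comment> \<open>This places \<open>z + \<alpha>\<close> at the discontinuity
      \<open>- real (Suc m) * \<theta>\<close> of \<open>T\<close>.\<close>
    define z where "z = - real (Suc m) * \<theta> - \<alpha>"
    \<comment> \<open>The known limit at \<open>z + c\<close> is carried over to \<open>z\<close> by
      moving both filters to 0.\<close>
    have right: "((\<lambda>y. T (y + c)) \<longlongrightarrow> T (z + c)) (at_right z)" for c
      using base_value_lower_sturmian_at_right[OF b \<theta>(1,2), of "z + c"]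
      unfolding T_def filterlim_at_right_to_0[of _ _ z] filterlim_at_right_to_0[of _ _ "z + c"]
      by (simp add: add_ac)
    have left: "((\<lambda>y. T (y + c)) \<longlongrightarrow> U (z + c)) (at_left z)" for c
      using base_value_lower_sturmian_at_left[OF b \<theta>(1,2), of "z + c"]
      unfolding T_def U_def filterlim_at_left_to_right[of _ _ z] filterlim_at_left_to_right[of _ _ "z + c"]
      filterlim_at_right_to_0[of _ _ "-z"] filterlim_at_right_to_0[of _ _ "- (z + c)"]
      by (simp add: algebra_simps)
    \<comment> \<open>\<open>T\<close> is right-continuous, so \<open>H z\<close> is the right limit
      of \<open>H\<close>; the left limit has \<open>U\<close> in place of \<open>T\<close>. Their
      difference is the jump.\<close>
    have "H z \<in> \<int>"
      unfolding H_def
      by (rule lim_right_Ints[where f = H and z = z, OF \<theta>(3) orbit, unfolded H_def]) (intro tendsto_intros right)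
    moreover have "of_int B * U (z + \<alpha>) + of_int C * U (z + \<beta>) \<in> \<int>"
      by (rule lim_left_Ints[where f = H and z = z, OF \<theta>(3) orbit, unfolded H_def]) (intro tendsto_intros left)
    ultimately have "H z - (of_int B * U (z + \<alpha>) + of_int C * U (z + \<beta>)) \<in> \<int>"
      by (rule Ints_diff)
    \<comment> \<open>The \<beta> term does not jump here: an integer on the orbit of
      \<open>z + \<beta>\<close> would make \<open>\<beta> - \<alpha>\<close> an integer combination
      of \<theta> and 1.\<close>
    moreover have "T (z + \<beta>) = U (z + \<beta>)"
    proof -
      have "real n * \<theta> + (z + \<beta>) \<notin> \<int>" for n :: nat
      proof
        assume "real n * \<theta> + (z + \<beta>) \<in> \<int>"
        then obtain i where "real n * \<theta> + (z + \<beta>) = of_int i" by (auto elim: Ints_cases)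
        then have "\<beta> - \<alpha> = of_int (int (Suc m) - int n) * \<theta> + of_int i"
          by (simp add: z_def algebra_simps)
        with nc show False by blast
      qed
      then show ?thesis unfolding T_def U_def by (subst lower_eq_upper_sturmian) auto
    qed
    moreover have "T (z + \<alpha>) - U (z + \<alpha>) = of_int (b - 1) / of_int b ^ (m + 2)"
      using base_value_sturmian_jump[OF b \<theta>] by (simp add: T_def U_def z_def)
    ultimately show ?thesis
      unfolding H_def by (simp add: algebra_simps flip: distrib_left right_diff_distrib)
  qed
  \<comment> \<open>Integers that tend to 0 are eventually 0, and the factor next to
    \<open>B\<close> never vanishes.\<close>
  have lim: "(\<lambda>m. of_int B * (of_int (b - 1) / of_int b ^ (m + 2)) :: real) \<longlonglongrightarrow> 0"
  proof -
    have "(\<lambda>m. of_int B * of_int (b - 1) * (1 / of_int b) ^ (m + 2) :: real) \<longlonglongrightarrow> of_int B * of_int (b - 1) * 0"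
      using b by (intro tendsto_mult tendsto_const LIMSEQ_ignore_initial_segment[OF LIMSEQ_power_zero]) simp
    then show ?thesis by (simp add: power_one_over divide_simps)
  qed
  then have "\<forall>\<^sub>F m in sequentially. \<bar>of_int B * (of_int (b - 1) / of_int b ^ (m + 2)) :: real\<bar> < 1"
    using order_tendstoD(2)[OF tendsto_rabs[OF lim], of 1] by simp
  then obtain m where "\<bar>of_int B * (of_int (b - 1) / of_int b ^ (m + 2)) :: real\<bar> < 1"
    by (auto simp: eventually_sequentially)
  then have "of_int B * (of_int (b - 1) / of_int b ^ (m + 2)) = (0 :: real)"
    using jump[of m] by (rule Ints_nonzero_abs_less1[rotated])
  then show "B = 0" using b by auto
qed

section \<open>Linear independence over the rationals\<close>

lemma clear_denominators:
  fixes q q' r :: rat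
  obtains D B C E :: int where "D > 0" "of_int D * q = of_int B" "of_int D * q' = of_int C"
    "of_int D * r = of_int E"
proof -
  obtain a d where q: "q = of_int a / of_int d" "d > 0" by (rule Rats_cases'[of q]) (auto simp: Rats_def)
  obtain a' d' where q': "q' = of_int a' / of_int d'" "d' > 0" by (rule Rats_cases'[of q']) (auto simp: Rats_def)
  obtain a'' d'' where r: "r = of_int a'' / of_int d''" "d'' > 0" by (rule Rats_cases'[of r]) (auto simp: Rats_def)
  show thesis
    by (rule that[of "d * d' * d''" "a * d' * d''" "a' * d * d''" "a'' * d * d'"]) (use q q' r in auto)
qed

lemma rat_lin_indep_three_iff:
  "rat_lin_indep [x, y, z] \<longleftrightarrow>
    (\<forall>p q r. of_rat p * x + of_rat q * y + of_rat r * z = 0 \<longrightarrow> p = 0 \<and> q = 0 \<and> r = 0)"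
proof -
  have "rat_lin_indep [x, y, z] \<longleftrightarrow>
    (\<forall>f::nat \<Rightarrow> rat. of_rat (f 0) * x + of_rat (f 1) * y + of_rat (f 2) * z = 0
        \<longrightarrow> f 0 = 0 \<and> f 1 = 0 \<and> f 2 = 0)"
    unfolding rat_lin_indep_def by (simp add: numeral_3_eq_3 numeral_2_eq_2 less_Suc_eq all_conj_distrib)
  also have "\<dots> \<longleftrightarrow> (\<forall>p q r. of_rat p * x + of_rat q * y + of_rat r * z = 0 \<longrightarrow> p = 0 \<and> q = 0 \<and> r = 0)"
  proof (intro iffI allI impI)
    fix p q r
    assume *: "\<forall>f::nat \<Rightarrow> rat. of_rat (f 0) * x + of_rat (f 1) * y + of_rat (f 2) * z = 0
        \<longrightarrow> f 0 = 0 \<and> f 1 = 0 \<and> f 2 = 0" and "of_rat p * x + of_rat q * y + of_rat r * z = 0"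
    then show "p = 0 \<and> q = 0 \<and> r = 0"
      using *[rule_format, of "\<lambda>i. if i = 0 then p else if i = 1 then q else r"] by simp
  qed blast
  finally show ?thesis .
qed

text \<open>Starting one position later adds \<theta> to the intercept 0. In this form both numbers
  are values of lower words, as \<open>int_relation_coeff_zero\<close> requires.\<close>

lemma char_sturmian_eq_lower: "char_sturmian \<theta> = lower_sturmian \<theta> \<theta>"
  by (rule ext) (simp add: char_sturmian_def lower_sturmian_def algebra_simps)

theorem theorem3:
  fixes b u v :: int and \<theta> \<rho> \<xi>\<^sub>0 \<xi>\<^sub>1 :: real and x :: "nat \<Rightarrow> int"
  assumes "b \<ge> 2"
    and "u \<in> {0..b - 1}" and "v \<in> {0..b - 1}" and "u \<noteq> v"
    and "0 < \<theta>" and "\<theta> < 1" and "\<theta> \<notin> \<rat>"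
    and "0 \<le> \<rho>" and "\<rho> < 1" and "is_sturmian u v \<theta> \<rho> x"
    and "\<xi>\<^sub>0 = base_value b (recode u v (char_sturmian \<theta>))"
    and "\<xi>\<^sub>1 = base_value b x"
  shows "rat_lin_indep [1, \<xi>\<^sub>0, \<xi>\<^sub>1] \<longleftrightarrow>
           \<not> (\<exists>j :: int. [\<rho> = of_int j * \<theta>] (rmod 1))"
proof
  assume indep: "rat_lin_indep [1, \<xi>\<^sub>0, \<xi>\<^sub>1]"
  show "\<not> (\<exists>j :: int. [\<rho> = of_int j * \<theta>] (rmod 1))"
  proof
    assume "\<exists>j :: int. [\<rho> = of_int j * \<theta>] (rmod 1)"
    then obtain j i :: int where \<rho>: "of_int j * \<theta> = \<rho> + of_int i"
      by (auto simp: rcong_altdef)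
    \<comment> \<open>\<open>M\<close> letters of \<open>x\<close> and \<open>K\<close> letters of
      the characteristic word are dropped to reach a common tail. \<open>M\<close> is at least
      \<open>1 - j\<close> to keep \<open>M + j - 1\<close> nonnegative; the 1 is there because the
      characteristic word has intercept \<theta>, not 0.\<close>
    define M where "M = nat (max 0 (1 - j))"
    define K where "K = nat (int M + j - 1)"
    have MK: "real M + of_int j = real K + 1"
      by (simp add: M_def K_def)
    have index: "real (n + M) * \<theta> + \<rho> = real (Suc (n + K)) * \<theta> + of_int (- i)" for n
    proof -
      have "real (n + M) * \<theta> + \<rho> = (real n + (real M + of_int j)) * \<theta> + of_int (- i)"
        using \<rho> by (simp add: algebra_simps)
      then show ?thesis unfolding MK by (simp add: algebra_simps)
    qed
    have lower: "lower_sturmian \<theta> \<rho> (n + M) = char_sturmian \<theta> (n + K)" for n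
      using index[of n] index[of "Suc n"]
      by (simp add: lower_sturmian_def char_sturmian_def)
    have upper: "upper_sturmian \<theta> \<rho> (n + M) = char_sturmian \<theta> (n + K)" for n
    proof -
      \<comment> \<open>The index \<open>Suc (n + K)\<close> is positive, which avoids the first
        letter, the only one where the upper word of intercept 0 departs from the lower one.\<close>
      have "upper_sturmian \<theta> \<rho> (n + M) = upper_sturmian \<theta> 0 (Suc (n + K))"
        using index[of n] index[of "Suc n"] by (simp add: upper_sturmian_def)
      then show ?thesis using upper_sturmian_zero[OF assms(5-7)] by simp
    qed
    define c where "c = recode u v (char_sturmian \<theta>)"
    have tail: "(\<lambda>n. x (n + M)) = (\<lambda>n. c (n + K))"
      using assms(10) lower upper by (auto simp: is_sturmian_def recode_def c_def)
    have digits: "\<bar>c n\<bar> \<le> b" "\<bar>x n\<bar> \<le> b" for n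
      using assms(2,3,10) by (auto simp: c_def recode_def is_sturmian_def)
    obtain k where k: "base_value b (\<lambda>n. c (n + K)) = of_int b ^ K * \<xi>\<^sub>0 - of_int k"
      using base_value_shift[where w = c, OF assms(1) digits(1)] assms(11) c_def by blast
    obtain l where l: "base_value b (\<lambda>n. x (n + M)) = of_int b ^ M * \<xi>\<^sub>1 - of_int l"
      using base_value_shift[where w = x, OF assms(1) digits(2)] assms(12) by blast
    \<comment> \<open>The common tail has one value, computed from \<open>\<xi>\<^sub>0\<close> and
      from \<open>\<xi>\<^sub>1\<close>; equating the two gives a relation with the nonzero
      coefficient \<open>b ^ K\<close>.\<close>
    have "of_rat (of_int (l - k)) * 1 + of_rat (of_int (b ^ K)) * \<xi>\<^sub>0 + of_rat (- of_int (b ^ M)) * \<xi>\<^sub>1 = 0"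
      using k l tail by (simp add: of_rat_minus of_rat_diff of_rat_power)
    with indep have "(of_int (b ^ K) :: rat) = 0"
      unfolding rat_lin_indep_three_iff by blast
    then show False using assms(1) by simp
  qed
next
  assume nc: "\<not> (\<exists>j :: int. [\<rho> = of_int j * \<theta>] (rmod 1))"
  have nc': "\<rho> \<noteq> of_int j * \<theta> + of_int i" for j i :: int
  proof
    assume "\<rho> = of_int j * \<theta> + of_int i"
    then have "of_int j * \<theta> = \<rho> + of_int (- i) * 1" by simp
    then show False using nc unfolding rcong_altdef by blast
  qed
  have "real n * \<theta> + \<rho> \<notin> \<int>" for n :: nat
  proof
    assume "real n * \<theta> + \<rho> \<in> \<int>"
    then obtain i where "real n * \<theta> + \<rho> = of_int i" by (auto elim: Ints_cases)
    then show False using nc'[of "- int n" i] by simp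
  qed
  \<comment> \<open>No point \<open>real n * \<theta> + \<rho>\<close> is an integer, so the lower
    and the upper word coincide.\<close>
  then have x: "x = recode u v (lower_sturmian \<theta> \<rho>)"
    using assms(10) lower_eq_upper_sturmian by (auto simp: is_sturmian_def)
  define X Y where "X = base_value b (lower_sturmian \<theta> \<theta>)" and "Y = base_value b (lower_sturmian \<theta> \<rho>)"
  have \<xi>: "\<xi>\<^sub>0 = of_int u / of_int (b - 1) + of_int (v - u) * X"
    "\<xi>\<^sub>1 = of_int u / of_int (b - 1) + of_int (v - u) * Y"
    unfolding assms(11,12) x char_sturmian_eq_lower X_def Y_def
    by (intro base_value_recode assms(1) lower_sturmian_range assms(5,6))+
  show "rat_lin_indep [1, \<xi>\<^sub>0, \<xi>\<^sub>1]"
    unfolding rat_lin_indep_three_iff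
  proof (intro allI impI)
    fix p q r :: rat
    assume rel: "of_rat p * 1 + of_rat q * \<xi>\<^sub>0 + of_rat r * \<xi>\<^sub>1 = 0"
    \<comment> \<open>The constant term after \<open>\<xi>\<^sub>0\<close> and
      \<open>\<xi>\<^sub>1\<close> are replaced by their affine expressions in \<open>X\<close> and
      \<open>Y\<close>.\<close>
    define s where "s = p + (q + r) * (of_int u / of_int (b - 1))"
    have rel': "of_rat s + of_int (v - u) * (of_rat q * X + of_rat r * Y) = (0::real)"
      using rel unfolding \<xi> s_def
      by (simp add: of_rat_add of_rat_mult of_rat_divide of_rat_diff algebra_simps add_divide_distrib)
    \<comment> \<open>The constant is divided by \<open>v - u\<close>, nonzero for distinct letters,
      before denominators are cleared; thus \<open>X\<close> and \<open>Y\<close> keep the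
      coefficients \<open>B\<close> and \<open>C\<close>, and the constant becomes an
      integer.\<close>
    obtain D B C E :: int where D: "D > 0" "of_int D * q = of_int B" "of_int D * r = of_int C"
      "of_int D * (s / of_int (v - u)) = of_int E"
      by (rule clear_denominators)
    have "of_int D * of_rat q = (of_int B :: real)" "of_int D * of_rat r = (of_int C :: real)"
      "of_int D * (of_rat s / of_int (v - u)) = (of_int E :: real)"
      using arg_cong[OF D(2), of "of_rat :: rat \<Rightarrow> real"] arg_cong[OF D(3), of "of_rat :: rat \<Rightarrow> real"]
        arg_cong[OF D(4), of "of_rat :: rat \<Rightarrow> real"]
      by (simp_all add: of_rat_mult of_rat_divide of_rat_diff)
    note D' = this
    have "of_rat q * X + of_rat r * Y = - (of_rat s / of_int (v - u))"
      using rel' assms(4) by (simp add: field_simps)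
    then have "of_int D * (of_rat q * X + of_rat r * Y) = - of_int E"
      using D'(3) by simp
    then have "of_int B * X + of_int C * Y = of_int (- E)"
      unfolding D'(1,2)[symmetric] by (simp add: algebra_simps)
    then have int: "of_int B * X + of_int C * Y \<in> \<int>" "of_int C * Y + of_int B * X \<in> \<int>"
      by (simp_all add: add.commute)
    \<comment> \<open>The intercepts compared are \<theta> and \<rho>, hence the shift of
      \<open>j\<close> by one in both non-congruence conditions; \<open>C = 0\<close> follows with
      the roles exchanged.\<close>
    have "B = 0"
    proof (rule int_relation_coeff_zero[OF assms(1,5-7) _ int(1)[unfolded X_def Y_def]])
      show "\<rho> - \<theta> \<noteq> of_int j * \<theta> + of_int i" for j i :: int
        using nc'[of "j + 1" i] by (simp add: algebra_simps)
    qed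
    moreover have "C = 0"
    proof (rule int_relation_coeff_zero[OF assms(1,5-7) _ int(2)[unfolded X_def Y_def]])
      show "\<theta> - \<rho> \<noteq> of_int j * \<theta> + of_int i" for j i :: int
        using nc'[of "1 - j" "- i"] by (simp add: algebra_simps)
    qed
    ultimately have "q = 0" "r = 0" using D by auto
    with rel show "p = 0 \<and> q = 0 \<and> r = 0" by simp
  qed
qed

end
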